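(* (i) Let $y>0$ and $x\ge 0$ be real and let $p\in\mathbb{C}$ with $\operatorname{Re}p>0$. Then $$ \exp(py)\,\operatorname{erfc}\left(y^{1/2}p^{1/2}\right)\operatorname{erf}\left(x^{1/2}p^{1/2}\right) =\frac1\pi\int_0^x e^{-pt}\frac{\sqrt y}{\sqrt t\,(y+t)}\,dt-\frac1\pi\int_x^\infty e^{-pt}\frac{\sqrt x}{\sqrt{y-x+t}\,(y+t)}\,dt . $$ (ii) Let $a>0$ and $b\ge 0$ be real. Then $$ \operatorname{erfc}(a)\operatorname{erf}(b)=\frac{a\,e^{-a^2}}{\pi}\int_0^{b^2}\frac{e^{-t}}{(t+a^2)\sqrt t}\,dt-\frac{b\,e^{-(a^2+b^2)}}{\pi}\int_0^\infty\frac{e^{-t}}{(t+a^2+b^2)\sqrt{t+a^2}}\,dt . $$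
   Context: $\operatorname{erf}(z)=\frac{2}{\sqrt\pi}\int_0^z e^{-s^2}ds$ is the error function and $\operatorname{erfc}(z)=1-\operatorname{erf}(z)$ is the complementary error function. Square roots are principal values. *)

theory Defs
  imports "HOL-Complex_Analysis.Complex_Analysis"
begin

text \<open>
  The integrand is entire, so the integral from \<open>0\<close> to \<open>z\<close> does not depend on the path;
  the straight segment is used.
\<close>

definition erf :: "complex \<Rightarrow> complex" where
  "erf z = complex_of_real (2 / sqrt pi) * contour_integral (linepath 0 z) (\<lambda>s. exp (- (s\<^sup>2)))"

definition erfc :: "complex \<Rightarrow> complex" where
  "erfc z = 1 - erf z"

end

theory Submission
  imports Defs "HOL-Probability.Distributions"
begin

text \<open>
  For fixed \<open>x, y > 0\<close> put \<open>H r = erfc (sqrt (r * y * p)) * erf (sqrt (r * x * p))\<close>. It tends to \<open>0\<close> as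
  \<open>r\<close> tends to infinity, so \<open>H 1\<close> is minus the integral of \<open>H'\<close> over \<open>{1<..}\<close>. By the product rule,
  and by writing erf and erfc as integrals of \<open>exp (- p * r * t) / sqrt t\<close>, \<open>H' r\<close> is a difference of
  two integrals over \<open>t\<close> of \<open>p * exp (- p * r * (y + t))\<close> against kernels that do not depend on \<open>r\<close>.
  Exchanging the integrals and integrating in \<open>r\<close> first produces the factor \<open>1 / (y + t)\<close>. The second
  formula is the case \<open>p = 1\<close>, \<open>y = a\<^sup>2\<close>, \<open>x = b\<^sup>2\<close>.
\<close>

section \<open>The error function: derivative and limits at infinity\<close>

text \<open>In the definition the segment of integration itself depends on \<open>z\<close>. An
  entire primitive \<open>g\<close> of the Gaussian removes this dependence: the segment integral is
  \<open>g z - g 0\<close>, so erf is differentiated through \<open>g\<close>.\<close>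

lemma has_field_derivative_erf:
  "(erf has_field_derivative of_real (2 / sqrt pi) * exp (- z\<^sup>2)) (at z)"
proof -
  have "(\<lambda>z::complex. exp (- z\<^sup>2)) holomorphic_on UNIV"
    by (intro holomorphic_intros)
  then obtain g where g: "\<And>z::complex. (g has_field_derivative exp (- z\<^sup>2)) (at z)"
    by (rule holomorphic_convex_primitive'[OF convex_UNIV open_UNIV]) auto
  have "erf z = of_real (2 / sqrt pi) * (g z - g 0)" for z
  proof -
    have "((\<lambda>s. exp (- s\<^sup>2)) has_contour_integral (g z - g 0)) (linepath 0 z)"
      using contour_integral_primitive[of UNIV g "\<lambda>s. exp (- s\<^sup>2)" "linepath 0 z"] g by simp
    then show ?thesis
      unfolding erf_def by (simp only: contour_integral_unique)
  qed
  then have erf_eq: "erf = (\<lambda>z. of_real (2 / sqrt pi) * (g z - g 0))"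
    by blast
  show ?thesis
    unfolding erf_eq by (rule derivative_eq_intros g refl)+ simp
qed

lemma erf_0 [simp]: "erf 0 = 0"
  by (simp add: erf_def)

lemma continuous_on_erf [continuous_intros]:
  "continuous_on S f \<Longrightarrow> continuous_on S (\<lambda>x. erf (f x))"
  by (rule continuous_on_compose2[of UNIV erf])
     (auto intro!: continuous_at_imp_continuous_on DERIV_isCont has_field_derivative_erf)

text \<open>On the nonnegative real axis erf is a Lebesgue integral over \<open>{0..r}\<close>,
  which tends to the half-line Gaussian moment \<open>sqrt pi / 2\<close>. This is the base case for
  the limit along other rays.\<close>

lemma erf_tendsto_1_real: "((\<lambda>r. erf (of_real r)) \<longlongrightarrow> 1) at_top"
proof -
  have int: "set_integrable lborel {0..} (\<lambda>t::real. exp (- t\<^sup>2))"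
    and val: "(LINT t:{0..}|lborel. exp (- t\<^sup>2 :: real)) = sqrt pi / 2"
    using gaussian_moment_0 by (auto simp: has_bochner_integral_iff set_integrable_def
        set_lebesgue_integral_def)
  have erf_eq: "of_real (2 / sqrt pi * (LINT t:{0..r}|lborel. exp (- t\<^sup>2))) = erf (of_real r)"
    if "r \<ge> 0" for r
  proof -
    have "(\<integral>t. indicator {0..r} t *\<^sub>R (of_real (2 / sqrt pi) * exp (- (of_real t)\<^sup>2)) \<partial>lborel)
            = erf (of_real r) - erf (of_real 0)"
      by (rule integral_FTC_atLeastAtMost[OF that])
         (auto intro!: continuous_intros has_field_derivative_erf DERIV_subset has_vector_derivative_real_field
           simp del: of_real_divide)
    also have "(\<integral>t. indicator {0..r} t *\<^sub>R (of_real (2 / sqrt pi) * exp (- (of_real t)\<^sup>2)) \<partial>lborel)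
        = (LINT t:{0..r}|lborel. complex_of_real (2 / sqrt pi * exp (- t\<^sup>2)))"
      unfolding set_lebesgue_integral_def 
      by (simp flip: exp_of_real)
    finally show ?thesis
      by (subst (asm) set_integral_complex_of_real) simp
  qed
  have "((\<lambda>r. complex_of_real (2 / sqrt pi * (LINT t:{0..r}|lborel. exp (- t\<^sup>2)))) \<longlongrightarrow>
         of_real (2 / sqrt pi * (sqrt pi / 2))) at_top"
    unfolding val[symmetric]
    by (intro tendsto_intros tendsto_set_lebesgue_integral_at_top int) auto
  then have "((\<lambda>r. complex_of_real (2 / sqrt pi * (LINT t:{0..r}|lborel. exp (- t\<^sup>2)))) \<longlongrightarrow> 1) at_top"
    by simp
  then show ?thesis
  proof (rule Lim_transform_eventually)
    show "\<forall>\<^sub>F r in at_top. of_real (2 / sqrt pi * (LINT t:{0..r}|lborel. exp (- t\<^sup>2))) = erf (of_real r)"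
      using eventually_ge_at_top[of 0] by eventually_elim (rule erf_eq)
  qed
qed

text \<open>On the chord from \<open>r * norm w\<close> to \<open>r * w\<close> the real part of the square is at least
  \<open>r\<^sup>2 * Re (w\<^sup>2)\<close>, so the two values of erf are asymptotically equal.\<close>

lemma erf_tendsto_1:
  assumes "Re w > 0" "Re (w\<^sup>2) > 0"
  shows "((\<lambda>r. erf (of_real r * w)) \<longlongrightarrow> 1) at_top"
proof -
  define c where "c = Re (w\<^sup>2)"
  have "c > 0" using assms by (simp add: c_def)
  have "((\<lambda>r. erf (of_real r * w) - erf (of_real (r * norm w))) \<longlongrightarrow> 0) at_top"
  proof (rule Lim_null_comparison)
    show "\<forall>\<^sub>F r in at_top. norm (erf (of_real r * w) - erf (of_real (r * norm w)))
            \<le> 2 / sqrt pi * exp (- (c * r\<^sup>2)) * (r * norm (w - of_real (norm w)))"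
      using eventually_ge_at_top[of 0]
    proof eventually_elim
      fix r :: real assume r: "r \<ge> 0"
      have Re: "c * r\<^sup>2 \<le> Re (z\<^sup>2)" if z: "z \<in> closed_segment (of_real r * w) (of_real (r * norm w))" for z
      proof -
        obtain u where u: "0 \<le> u" "u \<le> 1"
          "z = (1 - u) *\<^sub>R (of_real r * w) + u *\<^sub>R of_real (r * norm w)"
          using z unfolding in_segment by blast
        have Rez: "Re z = r * ((1 - u) * Re w + u * norm w)" and Imz: "Im z = r * ((1 - u) * Im w)"
          unfolding u(3) by (simp_all add: algebra_simps)
        \<comment> \<open>Since \<open>Re w\<close> is positive and at most \<open>norm w\<close>,
          the real part does not drop below \<open>r * Re w\<close> on the way to
          \<open>r * norm w\<close>, while the imaginary part shrinks to 0. Both effects can only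
          increase the real part of the square.\<close>
        have "Re w = (1 - u) * Re w + u * Re w"
          by (simp add: algebra_simps)
        also have "\<dots> \<le> (1 - u) * Re w + u * norm w"
          using u complex_Re_le_cmod[of w] by (intro add_left_mono mult_left_mono) auto
        finally have 1: "(Re w)\<^sup>2 \<le> ((1 - u) * Re w + u * norm w)\<^sup>2"
          using assms by (intro power_mono) auto
        have "\<bar>(1 - u) * Im w\<bar> \<le> 1 * \<bar>Im w\<bar>"
          unfolding abs_mult using u by (intro mult_right_mono) auto
        then have 2: "((1 - u) * Im w)\<^sup>2 \<le> (Im w)\<^sup>2"
          by (simp add: abs_le_square_iff)
        have "c * r\<^sup>2 = r\<^sup>2 * ((Re w)\<^sup>2 - (Im w)\<^sup>2)"
          by (simp add: c_def power2_eq_square)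
        also have "\<dots> \<le> r\<^sup>2 * (((1 - u) * Re w + u * norm w)\<^sup>2 - ((1 - u) * Im w)\<^sup>2)"
          using 1 2 by (intro mult_left_mono) auto
        also have "\<dots> = Re (z\<^sup>2)"
          unfolding Re_power2 Rez Imz power_mult_distrib[of r] by (rule right_diff_distrib)
        finally show ?thesis .
      qed
      \<comment> \<open>Mean value inequality on the chord: its length grows linearly in
        \<open>r\<close>, but the bound on the derivative decays like a Gaussian.\<close>
      have "norm (erf (of_real r * w) - erf (of_real (r * norm w)))
            \<le> 2 / sqrt pi * exp (- (c * r\<^sup>2)) * norm (of_real r * w - of_real (r * norm w))"
      proof (rule field_differentiable_bound)
        show "norm (of_real (2 / sqrt pi) * exp (- z\<^sup>2)) \<le> 2 / sqrt pi * exp (- (c * r\<^sup>2))"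
          if "z \<in> closed_segment (of_real r * w) (of_real (r * norm w))" for z
          using Re[OF that] by (simp add: norm_mult norm_divide divide_right_mono)
        show "(erf has_field_derivative of_real (2 / sqrt pi) * exp (- z\<^sup>2))
            (at z within closed_segment (of_real r * w) (of_real (r * norm w)))" for z
          by (rule has_field_derivative_at_within[OF has_field_derivative_erf])
      qed auto
      also have "of_real r * w - of_real (r * norm w) = of_real r * (w - of_real (norm w))"
        by (simp add: right_diff_distrib)
      also have "norm \<dots> = r * norm (w - of_real (norm w))"
        using r by (simp add: norm_mult)
      finally show "norm (erf (of_real r * w) - erf (of_real (r * norm w)))
            \<le> 2 / sqrt pi * exp (- (c * r\<^sup>2)) * (r * norm (w - of_real (norm w)))" .
    qed
    show "((\<lambda>r. 2 / sqrt pi * exp (- (c * r\<^sup>2)) * (r * norm (w - of_real (norm w)))) \<longlongrightarrow> 0) at_top"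
      using \<open>c > 0\<close> by real_asymp
  qed
  moreover have "((\<lambda>r. erf (of_real (r * norm w))) \<longlongrightarrow> 1) at_top"
  proof (rule filterlim_compose[OF erf_tendsto_1_real])
    have "norm w > 0" using assms by auto
    then show "LIM r at_top. r * norm w :> at_top"
      by real_asymp
  qed
  ultimately have "((\<lambda>r. (erf (of_real r * w) - erf (of_real (r * norm w))) + erf (of_real (r * norm w)))
      \<longlongrightarrow> 0 + 1) at_top"
    by (rule tendsto_add)
  then show ?thesis
    by simp
qed

section \<open>Exponential integrals over half-lines\<close>

text \<open>The real exponential is the norm of the complex one. It is nonnegative with a bounded
  primitive, hence integrable, and it dominates the complex integrand, whose integral then follows
  from its own primitive. The real value is used later for the integral of the norm in Fubini's
  theorem.\<close>

lemma set_integral_exp_greaterThan: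
  fixes c :: complex
  assumes "Re c > 0"
  shows "set_integrable lborel {a<..} (\<lambda>r. exp (- (c * of_real r)))"
    and "(LINT r:{a<..}|lborel. exp (- (c * of_real r))) = exp (- (c * of_real a)) / c"
    and "set_integrable lborel {a<..} (\<lambda>r. exp (- (Re c * r)))"
    and "(LINT r:{a<..}|lborel. exp (- (Re c * r))) = exp (- (Re c * a)) / Re c"
proof -
  have [simp]: "c \<noteq> 0" using assms by auto
  have lim: "((\<lambda>r. - exp (- (Re c * r)) / Re c) \<longlongrightarrow> 0) at_top"
    using assms by real_asymp
  have F': "((\<lambda>r. - exp (- (Re c * r)) / Re c) has_real_derivative exp (- (Re c * r))) (at r)" for r
    using assms by (auto intro!: derivative_eq_intros)
  have B: "(((\<lambda>r. - exp (- (Re c * r)) / Re c) \<circ> real_of_ereal) \<longlongrightarrow> 0) (at_left \<infinity>)"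
    using lim by (simp add: ereal_tendsto_simps)
  have A: "(((\<lambda>r. - exp (- (Re c * r)) / Re c) \<circ> real_of_ereal) \<longlongrightarrow> - exp (- (Re c * a)) / Re c)
        (at_right (ereal a))"
    unfolding ereal_tendsto_simps using assms by (intro tendsto_intros) auto
  note FTC = interval_integral_FTC_nonneg[OF _ F' _ _ A B]
  show i: "set_integrable lborel {a<..} (\<lambda>r. exp (- (Re c * r)))"
    using FTC(1) by (simp add: continuous_intros)
  show "(LINT r:{a<..}|lborel. exp (- (Re c * r))) = exp (- (Re c * a)) / Re c"
    using FTC(2) by (simp add: interval_integral_to_infinity_eq continuous_intros)
  show ic: "set_integrable lborel {a<..} (\<lambda>r. exp (- (c * of_real r)))"
    by (rule set_integrable_bound[OF i]) (simp_all add: set_borel_measurable_def)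
  have "(LBINT r=ereal a..\<infinity>. exp (- (c * of_real r))) = 0 - (- exp (- (c * of_real a)) / c)"
  proof (rule interval_integral_FTC_integrable)
    fix r
    show "((\<lambda>r. - exp (- (c * of_real r)) / c) has_vector_derivative exp (- (c * of_real r))) (at r)"
      by (rule has_vector_derivative_real_field) (auto intro!: derivative_eq_intros)
    show "isCont (\<lambda>r. exp (- (c * of_real r))) r"
      by (intro continuous_intros)
  next
    have "((\<lambda>r. - exp (- (c * of_real r)) / c) \<longlongrightarrow> 0) at_top"
    proof (rule tendsto_norm_zero_cancel)
      have "norm c > 0" by simp
      then have "((\<lambda>r. exp (- (Re c * r)) / norm c) \<longlongrightarrow> 0) at_top"
        using assms by real_asymp
      then show "((\<lambda>r. norm (- exp (- (c * of_real r)) / c)) \<longlongrightarrow> 0) at_top"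
        by (simp add: norm_divide)
    qed
    then show "(((\<lambda>r. - exp (- (c * of_real r)) / c) \<circ> real_of_ereal) \<longlongrightarrow> 0) (at_left \<infinity>)"
      by (simp add: ereal_tendsto_simps)
  next
    show "(((\<lambda>r. - exp (- (c * of_real r)) / c) \<circ> real_of_ereal) \<longlongrightarrow>
        - exp (- (c * of_real a)) / c) (at_right (ereal a))"
      unfolding ereal_tendsto_simps by (intro tendsto_intros) auto
  qed (use ic in simp_all)
  then show "(LINT r:{a<..}|lborel. exp (- (c * of_real r))) = exp (- (c * of_real a)) / c"
    by (simp add: interval_integral_to_infinity_eq)
qed

section \<open>erf and erfc as integrals of an exponential over a square root\<close>

text \<open>The substitution \<open>s = sqrt t * w\<close> turns the Gaussian in \<open>s\<close>
  into an exponential that is linear in \<open>t\<close>, at the price of the factor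
  \<open>1 / sqrt t\<close>. With \<open>w\<close> a square root of \<open>p\<close>, this gives the
  Laplace-type integrands of the claim.\<close>

lemma erf_sqrt_has_vector_derivative:
  assumes "t > 0"
  shows "((\<lambda>t. erf (of_real (sqrt t) * w)) has_vector_derivative
           w * exp (- (w\<^sup>2 * of_real t)) * of_real (1 / sqrt (pi * t))) (at t)"
proof -
  have sqrt': "((\<lambda>t. of_real (sqrt t) * w) has_vector_derivative of_real (inverse (sqrt t) / 2) * w) (at t)"
    using assms by (intro has_vector_derivative_mult_left has_vector_derivative_of_real)
      (auto intro!: derivative_eq_intros simp flip: has_real_derivative_iff_has_vector_derivative)
  have "(of_real (sqrt t) * w)\<^sup>2 = w\<^sup>2 * of_real ((sqrt t)\<^sup>2)"
    by (simp add: power_mult_distrib)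
  then have sq: "(of_real (sqrt t) * w)\<^sup>2 = w\<^sup>2 * of_real t"
    using assms by (simp del: of_real_power)
  have "of_real (inverse (sqrt t) / 2) * w * (of_real (2 / sqrt pi) * exp (- (of_real (sqrt t) * w)\<^sup>2)) =
      w * exp (- (w\<^sup>2 * of_real t)) * of_real (1 / sqrt (pi * t))"
    unfolding sq by (simp add: real_sqrt_mult divide_simps)
  with field_vector_diff_chain_at[OF sqrt' has_field_derivative_erf]
  show ?thesis
    by (simp only: comp_def)
qed

text \<open>The singularity at 0 is harmless because the primitive \<open>2 * sqrt t\<close> is
  continuous there.\<close>

lemma set_integrable_inverse_sqrt: "set_integrable lborel {0<..<a} (\<lambda>t. 1 / sqrt t)"
proof (cases "a > 0")
  case True
  have F: "((\<lambda>t. 2 * sqrt t) has_real_derivative 1 / sqrt t) (at t)" if "0 < ereal t" for t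
    using that by (auto intro!: derivative_eq_intros simp: field_simps)
  have A: "(((\<lambda>t. 2 * sqrt t) \<circ> real_of_ereal) \<longlongrightarrow> 2 * sqrt 0) (at_right (ereal 0))"
    unfolding ereal_tendsto_simps by (intro tendsto_intros)
  have B: "(((\<lambda>t. 2 * sqrt t) \<circ> real_of_ereal) \<longlongrightarrow> 2 * sqrt a) (at_left (ereal a))"
    unfolding ereal_tendsto_simps by (intro tendsto_intros)
  have C: "isCont (\<lambda>t. 1 / sqrt t) t" if "0 < ereal t" for t
    using that by (intro continuous_intros) auto
  have "set_integrable lborel (einterval (ereal 0) (ereal a)) (\<lambda>t. 1 / sqrt t)"
    by (rule interval_integral_FTC_nonneg(1)[OF _ F C _ A B]) (use True in auto)
  then show ?thesis by simp
qed (simp add: set_integrable_def)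

text \<open>Near 0 the exponential has norm at most 1 and the inverse square root dominates. Beyond
  \<open>y\<close> the inverse square root is at most \<open>1 / sqrt y\<close> and the exponential
  dominates.\<close>

lemma set_integrable_exp_div_sqrt:
  assumes "Re q > 0"
  shows "set_integrable lborel {0<..<x} (\<lambda>t. exp (- (q * of_real t)) * of_real (1 / sqrt t))"
    and "y > 0 \<Longrightarrow> set_integrable lborel {y<..} (\<lambda>t. exp (- (q * of_real t)) * of_real (1 / sqrt t))"
proof -
  show "set_integrable lborel {0<..<x} (\<lambda>t. exp (- (q * of_real t)) * of_real (1 / sqrt t))"
  proof (rule set_integrable_bound[OF set_integrable_inverse_sqrt])
    show "AE t in lborel. t \<in> {0<..<x} \<longrightarrow>
        norm (exp (- (q * of_real t)) * of_real (1 / sqrt t)) \<le> norm (1 / sqrt t)"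
      using assms by (auto simp: norm_mult norm_divide divide_right_mono)
  qed (simp add: set_borel_measurable_def)
  assume y: "y > 0"
  show "set_integrable lborel {y<..} (\<lambda>t. exp (- (q * of_real t)) * of_real (1 / sqrt t))"
  proof (rule set_integrable_bound)
    show "set_integrable lborel {y<..} (\<lambda>t. exp (- (Re q * t)) * (1 / sqrt y))"
      using set_integral_exp_greaterThan(3)[OF assms] by simp
    show "AE t in lborel. t \<in> {y<..} \<longrightarrow>
        norm (exp (- (q * of_real t)) * of_real (1 / sqrt t)) \<le> norm (exp (- (Re q * t)) * (1 / sqrt y))"
      using y by (auto simp: norm_mult norm_divide intro!: divide_left_mono mult_pos_pos)
  qed (simp add: set_borel_measurable_def)
qed

text \<open>Both formulas are the fundamental theorem of calculus for \<open>E\<close>. Its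
  derivative blows up at 0, but only one-sided limits of \<open>E\<close> at the ends are needed:
  \<open>E\<close> is continuous at 0, and it tends to 1 at infinity by the limit along the ray
  through \<open>w\<close>.\<close>

lemma
  assumes w: "Re w > 0" "Re (w\<^sup>2) > 0"
  shows erf_eq_integral: "x \<ge> 0 \<Longrightarrow> erf (of_real (sqrt x) * w) = w / of_real (sqrt pi) *
          (LINT t:{0<..<x}|lborel. exp (- (w\<^sup>2 * of_real t)) * of_real (1 / sqrt t))"
    and erfc_eq_integral: "y > 0 \<Longrightarrow> 1 - erf (of_real (sqrt y) * w) = w / of_real (sqrt pi) *
          (LINT t:{y<..}|lborel. exp (- (w\<^sup>2 * of_real t)) * of_real (1 / sqrt t))"
proof -
  define g where "g t = exp (- (w\<^sup>2 * of_real t)) * complex_of_real (1 / sqrt t)" for t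
  define E where "E t = erf (of_real (sqrt t) * w)" for t
  have E': "(E has_vector_derivative w / of_real (sqrt pi) * g t) (at t)" if "t > 0" for t
    using erf_sqrt_has_vector_derivative[OF that, of w]
    by (simp add: E_def[abs_def] g_def real_sqrt_mult mult_ac)
  have g_cont: "isCont (\<lambda>t. w / of_real (sqrt pi) * g t) t" if "t > 0" for t
    unfolding g_def using that by (intro continuous_intros) auto
  have g_int: "set_integrable lborel {0<..<t} g" "t > 0 \<Longrightarrow> set_integrable lborel {t<..} g" for t
    using set_integrable_exp_div_sqrt[OF w(2)] unfolding g_def by auto
  have E_cont: "continuous_on UNIV E"
    unfolding E_def by (intro continuous_intros)
  have left: "((E \<circ> real_of_ereal) \<longlongrightarrow> E t) (at_left (ereal t))"
    and right: "((E \<circ> real_of_ereal) \<longlongrightarrow> E t) (at_right (ereal t))" for t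
    unfolding ereal_tendsto_simps using E_cont
    by (auto simp: continuous_on_def intro: tendsto_within_subset)
  have top: "((E \<circ> real_of_ereal) \<longlongrightarrow> 1) (at_left \<infinity>)"
    unfolding ereal_tendsto_simps E_def
    by (rule filterlim_compose[OF erf_tendsto_1[OF w] sqrt_at_top])
  show "erf (of_real (sqrt x) * w) = w / of_real (sqrt pi) * (LINT t:{0<..<x}|lborel. g t)" if "x \<ge> 0"
  proof (cases "x = 0")
    case False
    have "(LBINT t=ereal 0..ereal x. w / of_real (sqrt pi) * g t) = E x - E 0"
      by (rule interval_integral_FTC_integrable[OF _ E' g_cont _ right left])
         (use False that g_int(1) in auto)
    then show ?thesis
      using that by (simp add: interval_lebesgue_integral_def E_def)
  qed (simp add: set_lebesgue_integral_def)
  show "1 - erf (of_real (sqrt y) * w) = w / of_real (sqrt pi) * (LINT t:{y<..}|lborel. g t)" if "y > 0"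
  proof -
    have "(LBINT t=ereal y..\<infinity>. w / of_real (sqrt pi) * g t) = 1 - E y"
      by (rule interval_integral_FTC_integrable[OF _ E' g_cont _ right top])
         (use that g_int(2) in auto)
    then show ?thesis
      by (simp add: interval_integral_to_infinity_eq E_def)
  qed
qed

section \<open>Exchanging the integrations in r and t\<close>

text \<open>Integrating \<open>p * exp (- p * r * (y + t))\<close> over \<open>r > 1\<close> gives
  \<open>exp (- p * (y + t)) / (y + t)\<close>; this is the source of the denominator
  \<open>y + t\<close>. The kernel \<open>k\<close> is kept general because the lemma serves both
  terms of the product rule, with different kernels and ranges.\<close>

lemma
  fixes k :: "real \<Rightarrow> real"
  assumes p: "Re p > 0" and y: "y > 0" and T [measurable]: "T \<in> sets borel" and T0: "T \<subseteq> {0..}"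
    and k [measurable]: "k \<in> borel_measurable borel" 
    and int: "set_integrable lborel T (\<lambda>t. exp (- (p * of_real t)) * of_real (k t))"
  shows set_integrable_exp_div: 
    "set_integrable lborel T (\<lambda>t. exp (- (p * of_real t)) * of_real (k t / (y + t)))"
    and set_integrable_Laplace: "set_integrable lborel {1<..} 
      (\<lambda>r. LINT t:T|lborel. p * exp (- (p * of_real (r * (y + t)))) * of_real (k t))"
    and set_integral_Laplace: "(LINT r:{1<..}|lborel.
      (LINT t:T|lborel. p * exp (- (p * of_real (r * (y + t)))) * of_real (k t)))
      = exp (- (p * of_real y)) * (LINT t:T|lborel. exp (- (p * of_real t)) * of_real (k t / (y + t)))"
proof -
  have Ty: "y + t > 0" if "t \<in> T" for t
    using that T0 y by force
  have [simp]: "p \<noteq> 0" using p by auto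
  show int': "set_integrable lborel T (\<lambda>t. exp (- (p * of_real t)) * of_real (k t / (y + t)))"
  proof (rule set_integrable_bound)
    show "set_integrable lborel T (\<lambda>t. exp (- (p * of_real t)) * of_real (k t) / of_real y)"
      using int by simp
    show "AE t in lborel. t \<in> T \<longrightarrow> norm (exp (- (p * of_real t)) * of_real (k t / (y + t)))
        \<le> norm (exp (- (p * of_real t)) * of_real (k t) / of_real y)"
    proof (intro AE_I2 impI)
      fix t assume "t \<in> T"
      then have "t \<ge> 0" using T0 by auto
      then have "\<bar>k t\<bar> / (y + t) \<le> \<bar>k t\<bar> / y"
        using y by (intro divide_left_mono) auto
      then show "norm (exp (- (p * of_real t)) * of_real (k t / (y + t)))
        \<le> norm (exp (- (p * of_real t)) * of_real (k t) / of_real y)"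
        using y \<open>t \<ge> 0\<close> by (simp add: norm_mult norm_divide mult_left_mono abs_divide del: of_real_add of_real_divide flip: times_divide_eq_right)
    qed
  qed (simp add: set_borel_measurable_def)
  define f where "f t r = indicator {1<..} r *\<^sub>R (indicator T t *\<^sub>R
      (p * exp (- (p * of_real (r * (y + t)))) * of_real (k t)))" for t r :: real
  have f_meas [measurable]: "case_prod f \<in> borel_measurable (lborel \<Otimes>\<^sub>M lborel)"
    unfolding f_def by measurable
  \<comment> \<open>Since \<open>y + t\<close> is real, the real part of \<open>p * (y + t)\<close>
    is \<open>Re p * (y + t)\<close>. So the integral of the norm carries the same factor
    \<open>1 / (y + t)\<close> and is a constant multiple of the norm of the integrand in
    \<open>int'\<close>.\<close>
  have f_inner: "integrable lborel (f t)" 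
      "(\<integral>r. f t r \<partial>lborel) = exp (- (p * of_real y)) * 
        (indicator T t *\<^sub>R (exp (- (p * of_real t)) * of_real (k t / (y + t))))"
      "(\<integral>r. norm (f t r) \<partial>lborel) = cmod p * exp (- (Re p * y)) / Re p *
        norm (indicator T t *\<^sub>R (exp (- (p * of_real t)) * of_real (k t / (y + t))))" for t
  proof -
    have "integrable lborel (f t) \<and> (\<integral>r. f t r \<partial>lborel) = exp (- (p * of_real y)) * 
        (indicator T t *\<^sub>R (exp (- (p * of_real t)) * of_real (k t / (y + t)))) \<and>
      (\<integral>r. norm (f t r) \<partial>lborel) = cmod p * exp (- (Re p * y)) / Re p *
        norm (indicator T t *\<^sub>R (exp (- (p * of_real t)) * of_real (k t / (y + t))))"
    proof (cases "t \<in> T")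
      case True
      define s where "s = y + t"
      define c where "c = p * of_real s"
      have s: "s > 0" using Ty[OF True] by (simp add: s_def)
      have c: "Re c > 0" using s p by (simp add: c_def)
      have exp_c: "exp (- (c * of_real 1)) = exp (- (p * of_real y)) * exp (- (p * of_real t))"
          "exp (- (Re c * 1)) = exp (- (Re p * y)) * exp (- (Re p * t))"
        by (simp_all add: c_def s_def algebra_simps flip: exp_add)
      have f1: "f t = (\<lambda>r. (p * of_real (k t)) * (indicator {1<..} r *\<^sub>R exp (- (c * of_real r))))"
        using True by (auto simp: f_def c_def s_def fun_eq_iff mult_ac indicator_def)
      have f2: "(\<lambda>r. norm (f t r)) = (\<lambda>r. (cmod p * \<bar>k t\<bar>) * (indicator {1<..} r *\<^sub>R exp (- (Re c * r))))"
        using True by (auto simp: f1 fun_eq_iff norm_mult)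
      note I = set_integral_exp_greaterThan[OF c, of 1, unfolded set_integrable_def set_lebesgue_integral_def]
      have "integrable lborel (f t)"
        unfolding f1 by (intro integrable_mult_right I)
      moreover have "(\<integral>r. f t r \<partial>lborel) = p * of_real (k t) * (exp (- (c * of_real 1)) / c)"
        unfolding f1 I(2)[symmetric] by (rule integral_mult_right_zero)
      then have "(\<integral>r. f t r \<partial>lborel) = exp (- (p * of_real y)) * 
        (indicator T t *\<^sub>R (exp (- (p * of_real t)) * of_real (k t / (y + t))))"
        using True s unfolding exp_c by (simp add: c_def flip: s_def)
      moreover have "(\<integral>r. norm (f t r) \<partial>lborel) = cmod p * \<bar>k t\<bar> * (exp (- (Re c * 1)) / Re c)"
        unfolding f2 I(4)[symmetric] by (rule integral_mult_right_zero)
      then have "(\<integral>r. norm (f t r) \<partial>lborel) = cmod p * exp (- (Re p * y)) / Re p *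
        norm (indicator T t *\<^sub>R (exp (- (p * of_real t)) * of_real (k t / (y + t))))"
        using True s p unfolding exp_c by (simp add: c_def norm_mult norm_divide flip: s_def)
      ultimately show ?thesis by blast
    qed (simp add: f_def[abs_def])
    then show "integrable lborel (f t)" 
      "(\<integral>r. f t r \<partial>lborel) = exp (- (p * of_real y)) * 
        (indicator T t *\<^sub>R (exp (- (p * of_real t)) * of_real (k t / (y + t))))"
      "(\<integral>r. norm (f t r) \<partial>lborel) = cmod p * exp (- (Re p * y)) / Re p *
        norm (indicator T t *\<^sub>R (exp (- (p * of_real t)) * of_real (k t / (y + t))))"
      by auto
  qed
  \<comment> \<open>Absolute integrability on the product thus reduces to
    \<open>int'\<close>.\<close>
  have f_int: "integrable (lborel \<Otimes>\<^sub>M lborel) (case_prod f)"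
  proof (rule lborel_pair.Fubini_integrable)
    show "integrable lborel (\<lambda>t. \<integral>r. norm (case_prod f (t, r)) \<partial>lborel)"
      unfolding prod.case f_inner
      by (intro integrable_mult_right integrable_norm int'[unfolded set_integrable_def])
    show "AE t in lborel. integrable lborel (\<lambda>r. case_prod f (t, r))"
      using f_inner(1) by simp
  qed measurable
  have f_outer: "(\<integral>t. f t r \<partial>lborel) = indicator {1<..} r *\<^sub>R
      (LINT t:T|lborel. p * exp (- (p * of_real (r * (y + t)))) * of_real (k t))" for r
    by (cases "r > 1") (simp_all add: f_def set_lebesgue_integral_def)
  show "set_integrable lborel {1<..} 
      (\<lambda>r. LINT t:T|lborel. p * exp (- (p * of_real (r * (y + t)))) * of_real (k t))"
    using lborel_pair.integrable_snd[OF f_int] unfolding f_outer set_integrable_def .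
  show "(LINT r:{1<..}|lborel.
      (LINT t:T|lborel. p * exp (- (p * of_real (r * (y + t)))) * of_real (k t)))
      = exp (- (p * of_real y)) * (LINT t:T|lborel. exp (- (p * of_real t)) * of_real (k t / (y + t)))"
    using lborel_pair.Fubini_integral[OF f_int]
    unfolding f_outer f_inner set_lebesgue_integral_def integral_mult_right_zero .
qed

section \<open>Translating half-lines, and the two kernels\<close>

text \<open>This moves the range of erfc from \<open>{y<..}\<close> to \<open>{x<..}\<close> and, in
  the real formula, moves \<open>{b\<^sup>2<..}\<close> to \<open>{0<..}\<close>.\<close>

lemma set_integral_shift:
  fixes f :: "real \<Rightarrow> 'a :: {banach, second_countable_topology}"
  shows "(LINT t:{a + c<..}|lborel. f t) = (LINT t:{a<..}|lborel. f (c + t))"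
    and "set_integrable lborel {a + c<..} f \<longleftrightarrow> set_integrable lborel {a<..} (\<lambda>t. f (c + t))"
proof -
  define g where "g t = indicator {a + c<..} t *\<^sub>R f t" for t
  have g: "g (c + 1 * t) = indicator {a<..} t *\<^sub>R f (c + t)" for t
    by (auto simp: g_def indicator_def)
  show "(LINT t:{a + c<..}|lborel. f t) = (LINT t:{a<..}|lborel. f (c + t))"
    using lborel_integral_real_affine[of 1 g c] unfolding g by (simp add: set_lebesgue_integral_def g_def[abs_def])
  show "set_integrable lborel {a + c<..} f \<longleftrightarrow> set_integrable lborel {a<..} (\<lambda>t. f (c + t))"
    using lborel_integrable_real_affine_iff[of 1 g c] unfolding g by (simp add: set_integrable_def g_def[abs_def])
qed

text \<open>The second kernel is the inverse square root on \<open>{y<..}\<close> translated by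
  \<open>y - x\<close>. The constant \<open>exp (p * (y - x))\<close> is inserted beforehand to
  cancel the factor that the translation produces.\<close>

lemma set_integrable_kernels:
  assumes p: "Re p > 0" and y: "y > 0"
  shows "set_integrable lborel {0<..<x} (\<lambda>t. exp (- (p * of_real t)) * of_real (1 / sqrt t))" (is ?A)
    and "set_integrable lborel {x<..} (\<lambda>t. exp (- (p * of_real t)) * of_real (1 / sqrt (y - x + t)))" (is ?B)
proof -
  show ?A by (rule set_integrable_exp_div_sqrt[OF p])
  have xy: "{x + (y - x)<..} = {y<..}" by simp
  have "set_integrable lborel {x + (y - x)<..}
      (\<lambda>t. exp (p * of_real (y - x)) * (exp (- (p * of_real t)) * of_real (1 / sqrt t)))"
    unfolding xy by (intro set_integrable_mult_right set_integrable_exp_div_sqrt(2)[OF p y])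
  then have "set_integrable lborel {x<..} (\<lambda>t. exp (p * of_real (y - x)) *
      (exp (- (p * of_real (y - x + t))) * of_real (1 / sqrt (y - x + t))))"
    unfolding set_integral_shift(2) .
  also have "(\<lambda>t. exp (p * of_real (y - x)) * (exp (- (p * of_real (y - x + t))) * of_real (1 / sqrt (y - x + t))))
      = (\<lambda>t. exp (- (p * of_real t)) * of_real (1 / sqrt (y - x + t)))"
    unfolding mult.assoc[symmetric] exp_add[symmetric] by (simp add: algebra_simps)
  finally show ?B .
qed

section \<open>The product formula for complex p\<close>

lemma erfc_erf_eq_integrals:
  fixes p :: complex
  assumes p: "Re p > 0" and y: "y > 0" and x: "x > 0"
  shows "(1 - erf (of_real (sqrt y) * csqrt p)) * erf (of_real (sqrt x) * csqrt p) =
    exp (- (p * of_real y)) * (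
      of_real (sqrt y / pi) * (LINT t:{0<..<x}|lborel. exp (- (p * of_real t)) * of_real (1 / sqrt t / (y + t)))
    - of_real (sqrt x / pi) * (LINT t:{x<..}|lborel. exp (- (p * of_real t)) * of_real (1 / sqrt (y - x + t) / (y + t))))"
proof -
  define w where "w = csqrt p"
  have w2: "w\<^sup>2 = p" by (simp add: w_def)
  \<comment> \<open>A purely imaginary \<open>w\<close> would have a square with nonpositive real
    part, and the principal root has no negative real part.\<close>
  have w0: "Re w > 0"
  proof -
    have "Re p = (Re w)\<^sup>2 - (Im w)\<^sup>2"
      by (simp only: Re_power2 flip: w2)
    with p have "Re w \<noteq> 0" by auto
    then show ?thesis
      using csqrt_principal[of p] by (auto simp: w_def)
  qed
  define e where "e s = erf (of_real (sqrt s) * w)" for s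
  define e' where "e' s = w * exp (- (p * of_real s)) * of_real (1 / sqrt (pi * s))" for s
  have e_deriv: "((\<lambda>r. e (c * r)) has_vector_derivative of_real c * e' (c * r)) (at r)" if "c > 0" "r > 0" for c r
  proof -
    have "((\<lambda>r. c * r) has_vector_derivative c) (at r)"
      by (auto intro!: derivative_eq_intros)
    from vector_diff_chain_at[OF this, of e "e' (c * r)"] show ?thesis
      using erf_sqrt_has_vector_derivative[of "c * r" w] that
      by (simp add: e_def[abs_def] e'_def w2 comp_def scaleR_conv_of_real)
  qed
  have e_cont: "continuous_on UNIV e"
    unfolding e_def by (intro continuous_intros)
  have e_top: "((\<lambda>r. e (c * r)) \<longlongrightarrow> 1) at_top" if "c > 0" for c
  proof -
    have "LIM r at_top. sqrt (c * r) :> at_top"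
      using that by real_asymp
    moreover have "((\<lambda>r. erf (of_real r * w)) \<longlongrightarrow> 1) at_top"
      by (rule erf_tendsto_1[OF w0]) (simp add: w2 p)
    ultimately show ?thesis
      unfolding e_def by (rule filterlim_compose[rotated])
  qed
  \<comment> \<open>The factor \<open>sqrt r\<close> is absorbed into \<open>w\<close>: the product
    again lies in the admissible sector and squares to \<open>p * r\<close>, so the integral
    representations apply with \<open>p * r\<close> in place of \<open>p\<close>.\<close>
  have scale: "e (c * r) = erf (of_real (sqrt c) * (of_real (sqrt r) * w))"
      "Re (of_real (sqrt r) * w) > 0" "(of_real (sqrt r) * w)\<^sup>2 = p * of_real r" "Re ((of_real (sqrt r) * w)\<^sup>2) > 0"
    if "r > 0" for c r
  proof -
    have "(complex_of_real (sqrt r))\<^sup>2 = of_real r"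
      using that by (metis of_real_power real_sqrt_pow2 less_imp_le)
    then show sq: "(of_real (sqrt r) * w)\<^sup>2 = p * of_real r"
      by (simp add: power_mult_distrib w2)
    show "Re ((of_real (sqrt r) * w)\<^sup>2) > 0"
      unfolding sq using p that by simp
    show "Re (of_real (sqrt r) * w) > 0" using w0 that by simp
    show "e (c * r) = erf (of_real (sqrt c) * (of_real (sqrt r) * w))"
      by (simp add: e_def real_sqrt_mult mult.assoc)
  qed
  \<comment> \<open>Here the powers of \<open>r\<close> cancel: \<open>1 / sqrt r\<close> from the
    derivative meets \<open>sqrt r\<close> from the integral representation, and the two factors
    \<open>w\<close> combine to \<open>p\<close>. This is why the kernels do not depend on
    \<open>r\<close>.\<close>
  have combine: "of_real c * e' (c * r) * ((of_real (sqrt r) * w) / of_real (sqrt pi) * J) =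
      of_real (sqrt c / pi) * (p * exp (- (p * of_real (c * r))) * J)" if "c > 0" "r > 0" for c r J
  proof -
    have "of_real c * e' (c * r) * ((of_real (sqrt r) * w) / of_real (sqrt pi) * J) =
        of_real (c * (1 / sqrt (pi * (c * r))) * sqrt r / sqrt pi) * (w\<^sup>2 * exp (- (p * of_real (c * r))) * J)"
      by (simp add: e'_def power2_eq_square)
    also have "c * (1 / sqrt (pi * (c * r))) * sqrt r / sqrt pi = sqrt c / pi"
      using that by (simp add: real_sqrt_mult field_simps)
    finally show ?thesis by (simp only: w2)
  qed
  have exp_combine: "p * exp (- (p * of_real (c * r))) * (exp (- (p * of_real r * of_real t)) * K) =
      p * exp (- (p * of_real (r * (c + t)))) * K" for c r t :: real and K :: complex
    by (simp add: algebra_simps flip: exp_add)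

  define A where "A r = (LINT t:{0<..<x}|lborel. p * exp (- (p * of_real (r * (y + t)))) * of_real (1 / sqrt t))" for r
  define B where "B r = (LINT t:{x<..}|lborel. p * exp (- (p * of_real (r * (y + t)))) * of_real (1 / sqrt (y - x + t)))" for r
  have A: "of_real y * e' (y * r) * e (x * r) = of_real (sqrt y / pi) * A r" if r: "r > 0" for r
  proof -
    have "of_real y * e' (y * r) * e (x * r) = of_real (sqrt y / pi) * (p * exp (- (p * of_real (y * r))) *
        (LINT t:{0<..<x}|lborel. exp (- (p * of_real r * of_real t)) * of_real (1 / sqrt t)))"
      unfolding scale(1)[OF r] erf_eq_integral[OF scale(2)[OF r] scale(4)[OF r] less_imp_le[OF x]] scale(3)[OF r]
      by (rule combine[OF y r])
    also have "p * exp (- (p * of_real (y * r))) *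
        (LINT t:{0<..<x}|lborel. exp (- (p * of_real r * of_real t)) * of_real (1 / sqrt t)) = A r"
      unfolding A_def set_integral_mult_right[symmetric]
      by (simp only: exp_combine)
    finally show ?thesis .
  qed
  \<comment> \<open>The range \<open>{y<..}\<close> of erfc is written as
    \<open>{x + (y - x)<..}\<close> and shifted to \<open>{x<..}\<close>. The exponent then becomes
    \<open>x + (y - x + t) = y + t\<close>, the same as in \<open>A\<close>, and the kernel becomes
    \<open>1 / sqrt (y - x + t)\<close>.\<close>
  have B: "(1 - e (y * r)) * (of_real x * e' (x * r)) = of_real (sqrt x / pi) * B r" if r: "r > 0" for r
  proof -
    have "(1 - e (y * r)) * (of_real x * e' (x * r)) = of_real x * e' (x * r) * (1 - e (y * r))"
      by (rule mult.commute)
    also have "\<dots> = of_real (sqrt x / pi) * (p * exp (- (p * of_real (x * r))) *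
        (LINT t:{x + (y - x)<..}|lborel. exp (- (p * of_real r * of_real t)) * of_real (1 / sqrt t)))"
      unfolding scale(1)[OF r] erfc_eq_integral[OF scale(2)[OF r] scale(4)[OF r] y] scale(3)[OF r]
      by (simp only: combine[OF x r] add_diff_cancel_left' add_diff_inverse diff_add_cancel add_diff_eq)
    also have "p * exp (- (p * of_real (x * r))) *
        (LINT t:{x + (y - x)<..}|lborel. exp (- (p * of_real r * of_real t)) * of_real (1 / sqrt t)) = B r"
      unfolding set_integral_shift(1) B_def set_integral_mult_right[symmetric]
      by (simp only: exp_combine add_diff_eq add_diff_cancel_left' diff_add_cancel add.assoc[symmetric])
    finally show ?thesis .
  qed

  have T: "{0<..<x} \<subseteq> {0..}" "{x<..} \<subseteq> {0..}" using x by auto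
  note LA = set_integrable_Laplace[OF p y _ T(1) _ set_integrable_kernels(1)[OF p y], folded A_def]
    set_integral_Laplace[OF p y _ T(1) _ set_integrable_kernels(1)[OF p y], folded A_def]
  note LB = set_integrable_Laplace[OF p y _ T(2) _ set_integrable_kernels(2)[OF p y], folded B_def]
    set_integral_Laplace[OF p y _ T(2) _ set_integrable_kernels(2)[OF p y], folded B_def]
  have A_int: "set_integrable lborel {1<..} A" and B_int: "set_integrable lborel {1<..} B"
    using LA(1) LB(1) by simp_all

  define H where "H r = (1 - e (y * r)) * e (x * r)" for r
  define H' where "H' r = (1 - e (y * r)) * (of_real x * e' (x * r)) - of_real y * e' (y * r) * e (x * r)" for r
  have H'_eq: "H' r = of_real (sqrt x / pi) * B r - of_real (sqrt y / pi) * A r" if "r > 0" for r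
    unfolding H'_def A[OF that] B[OF that] ..
  have H_cont: "continuous_on UNIV H"
    unfolding H_def by (intro continuous_intros continuous_on_compose2[OF e_cont]) auto
  have "(LBINT r=ereal 1..\<infinity>. H' r) = 0 - H 1"
  proof (rule interval_integral_FTC_integrable)
    fix r :: real assume "ereal 1 < ereal r"
    then have r: "r > 0" by simp
    show "(H has_vector_derivative H' r) (at r)"
      unfolding H_def H'_def using e_deriv[OF x r] e_deriv[OF y r]
      by (auto intro!: derivative_eq_intros)
    have ec: "isCont (\<lambda>r. e (c * r)) r" for c
      using e_cont by (intro continuous_on_interior[of UNIV] continuous_on_compose2[OF e_cont] continuous_intros) auto
    show "isCont H' r"
      unfolding H'_def e'_def using r x y by (intro continuous_intros ec) auto
  next
    \<comment> \<open>Integrability of \<open>H'\<close> needs no estimate of its own: on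
      \<open>{1<..}\<close> it is a combination of \<open>A\<close> and \<open>B\<close>, whose
      integrability came from Fubini's theorem.\<close>
    have "set_integrable lborel {1<..} (\<lambda>r. of_real (sqrt x / pi) * B r - of_real (sqrt y / pi) * A r)"
      using A_int B_int by (intro set_integral_diff set_integrable_mult_right)
    also have "?this \<longleftrightarrow> set_integrable lborel {1<..} H'"
      by (intro set_integrable_cong) (auto simp: H'_eq)
    finally show "set_integrable lborel (einterval (ereal 1) \<infinity>) H'" by simp
  next
    show "((H \<circ> real_of_ereal) \<longlongrightarrow> H 1) (at_right (ereal 1))"
      unfolding ereal_tendsto_simps using H_cont
      by (auto simp: continuous_on_def intro: tendsto_within_subset)
    \<comment> \<open>The erfc factor tends to 0 and, as \<open>x > 0\<close>, the erf factor tends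
      to 1.\<close>
    have "(H \<longlongrightarrow> (1 - 1) * 1) at_top"
      unfolding H_def by (intro tendsto_intros e_top x y)
    then show "((H \<circ> real_of_ereal) \<longlongrightarrow> 0) (at_left \<infinity>)"
      by (simp add: ereal_tendsto_simps)
  qed simp
  also have "(LBINT r=ereal 1..\<infinity>. H' r) =
      (LINT r:{1<..}|lborel. of_real (sqrt x / pi) * B r - of_real (sqrt y / pi) * A r)"
    unfolding interval_integral_to_infinity_eq by (intro set_lebesgue_integral_cong) (auto simp: H'_eq)
  also have "\<dots> = of_real (sqrt x / pi) * (LINT r:{1<..}|lborel. B r) - of_real (sqrt y / pi) * (LINT r:{1<..}|lborel. A r)"
    using A_int B_int by (subst set_integral_diff) (auto simp del: of_real_divide)
  finally have "H 1 = of_real (sqrt y / pi) * (LINT r:{1<..}|lborel. A r) - of_real (sqrt x / pi) * (LINT r:{1<..}|lborel. B r)"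
    by (simp add: algebra_simps)
  also have "(LINT r:{1<..}|lborel. A r) = exp (- (p * of_real y)) *
      (LINT t:{0<..<x}|lborel. exp (- (p * of_real t)) * of_real (1 / sqrt t / (y + t)))"
    by (rule LA(2)) simp_all
  also have "(LINT r:{1<..}|lborel. B r) = exp (- (p * of_real y)) *
      (LINT t:{x<..}|lborel. exp (- (p * of_real t)) * of_real (1 / sqrt (y - x + t) / (y + t)))"
    by (rule LB(2)) simp_all
  finally show ?thesis
    by (simp add: H_def e_def w_def algebra_simps)
qed

lemma set_integrable_integrands:
  assumes p: "Re p > 0" and y: "y > 0" and x: "x \<ge> 0"
  shows "set_integrable lborel {0<..<x} (\<lambda>t. exp (- (p * of_real t)) * of_real (1 / (sqrt t * (y + t))))"
    and "set_integrable lborel {x<..} (\<lambda>t. exp (- (p * of_real t)) * of_real (1 / (sqrt (y - x + t) * (y + t))))"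
proof -
  have T: "{0<..<x} \<subseteq> {0..}" "{x<..} \<subseteq> {0..}" using x by auto
  show "set_integrable lborel {0<..<x} (\<lambda>t. exp (- (p * of_real t)) * of_real (1 / (sqrt t * (y + t))))"
    using set_integrable_exp_div[OF p y _ T(1) _ set_integrable_kernels(1)[OF p y]] by simp
  show "set_integrable lborel {x<..} (\<lambda>t. exp (- (p * of_real t)) * of_real (1 / (sqrt (y - x + t) * (y + t))))"
    using set_integrable_exp_div[OF p y _ T(2) _ set_integrable_kernels(2)[OF p y]] by simp
qed

text \<open>For \<open>x > 0\<close> the factor \<open>exp (p * y)\<close> cancels the one on the
  right of the previous formula. For \<open>x = 0\<close> both sides vanish: erf is 0 at 0, the
  first range is empty, and the second integrand has the factor \<open>sqrt x\<close>.\<close>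

lemma erfc_erf_eq:
  assumes p: "Re p > 0" and y: "y > 0" and x: "x \<ge> 0"
  shows "exp (p * of_real y) * (1 - erf (of_real (sqrt y) * csqrt p)) * erf (of_real (sqrt x) * csqrt p) =
    of_real (1 / pi) * (LINT t:{0<..<x}|lborel. exp (- (p * of_real t)) * of_real (sqrt y / (sqrt t * (y + t))))
    - of_real (1 / pi) * (LINT t:{x<..}|lborel. exp (- (p * of_real t)) * of_real (sqrt x / (sqrt (y - x + t) * (y + t))))"
proof (cases "x = 0")
  case False
  define I where "I = (LINT t:{0<..<x}|lborel. exp (- (p * of_real t)) * complex_of_real (1 / sqrt t / (y + t)))"
  define J where "J = (LINT t:{x<..}|lborel. exp (- (p * of_real t)) * complex_of_real (1 / sqrt (y - x + t) / (y + t)))"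
  have I: "(LINT t:{0<..<x}|lborel. exp (- (p * of_real t)) * complex_of_real (sqrt y / (sqrt t * (y + t)))) =
      of_real (sqrt y) * I"
    unfolding I_def set_integral_mult_right[symmetric] by (simp add: mult_ac)
  have J: "(LINT t:{x<..}|lborel. exp (- (p * of_real t)) * complex_of_real (sqrt x / (sqrt (y - x + t) * (y + t)))) =
      of_real (sqrt x) * J"
    unfolding J_def set_integral_mult_right[symmetric] by (simp add: mult_ac)
  have "exp (p * of_real y) * ((1 - erf (of_real (sqrt y) * csqrt p)) * erf (of_real (sqrt x) * csqrt p)) =
      (exp (p * of_real y) * exp (- (p * of_real y))) * (of_real (sqrt y / pi) * I - of_real (sqrt x / pi) * J)"
    using erfc_erf_eq_integrals[OF p y, of x] False x by (simp add: I_def J_def)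
  then show ?thesis
    unfolding I J by (simp add: mult.assoc flip: exp_add)
qed (simp add: set_lebesgue_integral_def)

section \<open>The real formula\<close>

lemma set_integrable_complex_of_real_iff:
  "set_integrable M A (\<lambda>t. complex_of_real (f t)) \<longleftrightarrow> set_integrable M A f"
  using complex_of_real_integrable_eq[of M "\<lambda>t. indicator A t *\<^sub>R f t"]
  by (simp add: set_integrable_def scaleR_conv_of_real)

text \<open>In the case \<open>p = 1\<close>, \<open>y = a\<^sup>2\<close>,
  \<open>x = b\<^sup>2\<close>, shifting the second integral by \<open>b\<^sup>2\<close> produces
  the factor \<open>exp (- b\<^sup>2)\<close> and turns \<open>y - x + t\<close> into
  \<open>t + a\<^sup>2\<close>.\<close>

lemma erfc_erf_real_eq:
  fixes a b :: real
  assumes a: "a > 0" and b: "b \<ge> 0"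
  shows "set_integrable lborel {0<..<b\<^sup>2} (\<lambda>t. exp (- t) / ((t + a\<^sup>2) * sqrt t))" (is ?int1)
    and "set_integrable lborel {0<..} (\<lambda>t. exp (- t) / ((t + a\<^sup>2 + b\<^sup>2) * sqrt (t + a\<^sup>2)))" (is ?int2)
    and "(1 - erf (of_real a)) * erf (of_real b) = of_real
      (a * exp (- a\<^sup>2) / pi * (LINT t:{0<..<b\<^sup>2}|lborel. exp (- t) / ((t + a\<^sup>2) * sqrt t))
      - b * exp (- (a\<^sup>2 + b\<^sup>2)) / pi *
        (LINT t:{0<..}|lborel. exp (- t) / ((t + a\<^sup>2 + b\<^sup>2) * sqrt (t + a\<^sup>2))))" (is ?eq)
proof -
  define f1 where "f1 t = exp (- t) / ((t + a\<^sup>2) * sqrt t)" for t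
  define f2 where "f2 t = exp (- t) / ((t + a\<^sup>2 + b\<^sup>2) * sqrt (t + a\<^sup>2))" for t
  have y: "a\<^sup>2 > 0" and x: "b\<^sup>2 \<ge> 0" using a by auto
  \<comment> \<open>The numerator \<open>c\<close> is 1 for integrability, and the root of
    \<open>a\<^sup>2\<close> or \<open>b\<^sup>2\<close> for the formula.\<close>
  have g1: "exp (- (1 * complex_of_real t)) * of_real (c / (sqrt t * (a\<^sup>2 + t))) = of_real (c * f1 t)" for c t
    by (simp add: f1_def exp_of_real[symmetric] mult_ac add_ac)
  have g2: "exp (- (1 * complex_of_real (b\<^sup>2 + t))) * of_real (c / (sqrt (a\<^sup>2 - b\<^sup>2 + (b\<^sup>2 + t)) * (a\<^sup>2 + (b\<^sup>2 + t))))
      = of_real (exp (- b\<^sup>2) * c * f2 t)" for c t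
    by (simp add: f2_def exp_of_real[symmetric] exp_diff exp_add exp_minus field_simps)
  have b2: "{b\<^sup>2<..} = {0 + b\<^sup>2<..}" by simp
  have p: "Re 1 > 0" by simp
  note int = set_integrable_integrands[OF p y x]
  show ?int1
    using int(1) unfolding g1 set_integrable_complex_of_real_iff by (simp add: f1_def)
  have "set_integrable lborel {0<..} (\<lambda>t. exp (- b\<^sup>2) * 1 * f2 t)"
    using int(2) unfolding b2 set_integral_shift g2 set_integrable_complex_of_real_iff .
  \<comment> \<open>Multiplying by \<open>exp (b\<^sup>2)\<close> removes the constant left by the
    shift.\<close>
  then have "set_integrable lborel {0<..} (\<lambda>t. exp (b\<^sup>2) * (exp (- b\<^sup>2) * 1 * f2 t))"
    by (rule set_integrable_mult_right)
  then show ?int2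
    by (simp add: f2_def flip: mult.assoc exp_add)
  have "exp (of_real (a\<^sup>2)) * (1 - erf (of_real a)) * erf (of_real b) =
      of_real (1 / pi) * of_real (a * (LINT t:{0<..<b\<^sup>2}|lborel. f1 t))
      - of_real (1 / pi) * of_real (exp (- b\<^sup>2) * b * (LINT t:{0<..}|lborel. f2 t))"
    using erfc_erf_eq[OF p y x] a b
    unfolding b2 set_integral_shift g1 g2 set_integral_complex_of_real set_integral_mult_right
    by (simp add: real_sqrt_abs)
  then have "exp (of_real (- a\<^sup>2)) * (exp (of_real (a\<^sup>2)) * (1 - erf (of_real a)) * erf (of_real b)) =
      of_real (exp (- a\<^sup>2) * (1 / pi * (a * (LINT t:{0<..<b\<^sup>2}|lborel. f1 t))
      - 1 / pi * (exp (- b\<^sup>2) * b * (LINT t:{0<..}|lborel. f2 t))))"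
    by (simp only: of_real_diff of_real_mult exp_of_real)
  also have "exp (of_real (- a\<^sup>2)) * (exp (of_real (a\<^sup>2)) * (1 - erf (of_real a)) * erf (of_real b)) =
      (1 - erf (of_real a)) * erf (of_real b)"
    by (simp add: exp_minus)
  also have "exp (- a\<^sup>2) * (1 / pi * (a * (LINT t:{0<..<b\<^sup>2}|lborel. f1 t))
      - 1 / pi * (exp (- b\<^sup>2) * b * (LINT t:{0<..}|lborel. f2 t))) =
      a * exp (- a\<^sup>2) / pi * (LINT t:{0<..<b\<^sup>2}|lborel. f1 t)
      - b * exp (- (a\<^sup>2 + b\<^sup>2)) / pi * (LINT t:{0<..}|lborel. f2 t)"
    unfolding minus_add_distrib exp_add by (simp add: algebra_simps)
  finally show ?eq
    unfolding f1_def f2_def .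
qed

section \<open>Both formulas as interval integrals\<close>

theorem corollary3p2p1:
  shows "(\<forall>(y::real) (x::real) (p::complex). y > 0 \<and> x \<ge> 0 \<and> Re p > 0 \<longrightarrow>
      interval_lebesgue_integrable lborel (ereal 0) (ereal x)
        (\<lambda>t. exp (- (p * complex_of_real t)) * complex_of_real (sqrt y / (sqrt t * (y + t)))) \<and>
      interval_lebesgue_integrable lborel (ereal x) \<infinity>
        (\<lambda>t. exp (- (p * complex_of_real t)) * complex_of_real (sqrt x / (sqrt (y - x + t) * (y + t)))) \<and>
      exp (p * complex_of_real y) * erfc (csqrt (complex_of_real y) * csqrt p)
          * erf (csqrt (complex_of_real x) * csqrt p)
        = complex_of_real (1 / pi) * (LBINT t=ereal 0..ereal x.
            exp (- (p * complex_of_real t)) * complex_of_real (sqrt y / (sqrt t * (y + t))))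
        - complex_of_real (1 / pi) * (LBINT t=ereal x..\<infinity>.
            exp (- (p * complex_of_real t)) * complex_of_real (sqrt x / (sqrt (y - x + t) * (y + t)))))
    \<and> (\<forall>(a::real) (b::real). a > 0 \<and> b \<ge> 0 \<longrightarrow>
      interval_lebesgue_integrable lborel (ereal 0) (ereal (b\<^sup>2))
        (\<lambda>t. exp (- t) / ((t + a\<^sup>2) * sqrt t)) \<and>
      interval_lebesgue_integrable lborel (ereal 0) \<infinity>
        (\<lambda>t. exp (- t) / ((t + a\<^sup>2 + b\<^sup>2) * sqrt (t + a\<^sup>2))) \<and>
      erfc (complex_of_real a) * erf (complex_of_real b)
        = complex_of_real
           (a * exp (- (a\<^sup>2)) / pi *
              (LBINT t=ereal 0..ereal (b\<^sup>2). exp (- t) / ((t + a\<^sup>2) * sqrt t))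
          - b * exp (- (a\<^sup>2 + b\<^sup>2)) / pi *
              (LBINT t=ereal 0..\<infinity>. exp (- t) / ((t + a\<^sup>2 + b\<^sup>2) * sqrt (t + a\<^sup>2)))))"
proof (intro conjI allI impI; (elim conjE)?)
  fix y x :: real and p :: complex
  assume y: "y > 0" and x: "x \<ge> 0" and p: "Re p > 0"
  \<comment> \<open>The integrability facts have numerator 1; the constants \<open>sqrt y\<close>
    and \<open>sqrt x\<close> are restored as scalar multiples.\<close>
  note int = set_integrable_integrands[OF p y x, THEN set_integrable_mult_right]
  show "interval_lebesgue_integrable lborel (ereal 0) (ereal x)
        (\<lambda>t. exp (- (p * complex_of_real t)) * complex_of_real (sqrt y / (sqrt t * (y + t))))"
    using int(1)[of "of_real (sqrt y)"] x by (simp add: interval_lebesgue_integrable_def mult_ac)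
  show "interval_lebesgue_integrable lborel (ereal x) \<infinity>
        (\<lambda>t. exp (- (p * complex_of_real t)) * complex_of_real (sqrt x / (sqrt (y - x + t) * (y + t))))"
    using int(2)[of "of_real (sqrt x)"] by (simp add: interval_integrable_to_infinity_eq mult_ac)
  show "exp (p * complex_of_real y) * erfc (csqrt (complex_of_real y) * csqrt p)
          * erf (csqrt (complex_of_real x) * csqrt p)
        = complex_of_real (1 / pi) * (LBINT t=ereal 0..ereal x.
            exp (- (p * complex_of_real t)) * complex_of_real (sqrt y / (sqrt t * (y + t))))
        - complex_of_real (1 / pi) * (LBINT t=ereal x..\<infinity>.
            exp (- (p * complex_of_real t)) * complex_of_real (sqrt x / (sqrt (y - x + t) * (y + t))))"
    \<comment> \<open>On nonnegative reals the principal complex root is the real root.\<close>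
    using erfc_erf_eq[OF p y x] x y
    by (simp only: interval_lebesgue_integral_le_eq ereal_less_eq einterval_eq interval_integral_to_infinity_eq
        erfc_def of_real_sqrt less_imp_le)
next
  fix a b :: real
  assume ab: "a > 0" "b \<ge> 0"
  note * = erfc_erf_real_eq[OF ab]
  show "interval_lebesgue_integrable lborel (ereal 0) (ereal (b\<^sup>2))
        (\<lambda>t. exp (- t) / ((t + a\<^sup>2) * sqrt t))"
    using *(1) by (simp add: interval_lebesgue_integrable_def)
  show "interval_lebesgue_integrable lborel (ereal 0) \<infinity>
        (\<lambda>t. exp (- t) / ((t + a\<^sup>2 + b\<^sup>2) * sqrt (t + a\<^sup>2)))"
    using *(2) by (simp add: interval_integrable_to_infinity_eq)
  show "erfc (complex_of_real a) * erf (complex_of_real b)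
        = complex_of_real
           (a * exp (- (a\<^sup>2)) / pi *
              (LBINT t=ereal 0..ereal (b\<^sup>2). exp (- t) / ((t + a\<^sup>2) * sqrt t))
          - b * exp (- (a\<^sup>2 + b\<^sup>2)) / pi *
              (LBINT t=ereal 0..\<infinity>. exp (- t) / ((t + a\<^sup>2 + b\<^sup>2) * sqrt (t + a\<^sup>2))))"
    using *(3)
    by (simp only: interval_lebesgue_integral_le_eq ereal_less_eq einterval_eq interval_integral_to_infinity_eq
        erfc_def zero_le_power2)
qed

end
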